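(* Let $n\ge 1$ and let $0 \leq x_1 \leq x_2 \leq \dots \leq x_n \leq 1$ be given (in sorted order). Then a point $$x_{n+1} = \arg\min_{0 \leq x \leq 1} E(x_1, \dots, x_n, x)$$ can be computed using $\mathcal{O}(n)$ operations. Moreover, any such minimizer is a rational number of the form $x_{n+1} = k/(n+1)$ with $k$ an integer, $1 \leq k \leq n+1$. Finally, if $x_{n+1} = (k+1)/(n+1)$ for an integer $k$ with $1 \leq k \leq n-1$, then $$x_k < \frac{k+1}{n+1} < x_{k+1}.$$
   Context: For $N\ge 1$ and points $y_1,\dots,y_N\in[0,1]$ the energy is $$E(y_1,\dots,y_N) = \min_{\pi\in S_N}\sum_{i=1}^{N}\left|y_{\pi(i)}-\frac{i}{N}\right|,$$ where $\pi$ ranges over all permutations of $\{1,\dots,N\}$. If $y_1\le y_2\le\dots\le y_N$, then $E(y_1,\dots,y_N)=\sum_{i=1}^N |y_i-i/N|$. In particular $E(x_1,\dots,x_n,x)$ is the energy of $n+1$ points, with targets $i/(n+1)$. Operations are counted as elementary arithmetic operations and comparisons on real numbers, and the implied constant in $\mathcal{O}(n)$ is absolute. *)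

theory Defs
  imports Complex_Main "HOL-Combinatorics.Permutations"
begin

section \<open>Energy and its minimizers\<close>

text \<open>A tuple \<open>(y\<^sub>1, \<dots>, y\<^sub>N)\<close> is a function \<open>y\<close> of which only the values on
  \<open>{1..N}\<close> matter.\<close>

definition energy :: "nat \<Rightarrow> (nat \<Rightarrow> real) \<Rightarrow> real" where
  "energy N y =
     Min ((\<lambda>\<pi>. \<Sum>i=1..N. \<bar>y (\<pi> i) - real i / real N\<bar>) ` {\<pi>. \<pi> permutes {1..N}})"

definition sorted_points :: "nat \<Rightarrow> (nat \<Rightarrow> real) \<Rightarrow> bool" where
  "sorted_points n x \<longleftrightarrow> x ` {1..n} \<subseteq> {0..1} \<and> mono_on {1..n} x"

definition minimizer :: "nat \<Rightarrow> (nat \<Rightarrow> real) \<Rightarrow> real \<Rightarrow> bool" where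
  "minimizer n x z \<longleftrightarrow>
     is_arg_min (\<lambda>y. energy (n + 1) (x(n + 1 := y))) (\<lambda>y. 0 \<le> y \<and> y \<le> 1) z"

section \<open>A real random access machine\<close>

text \<open>The machine has natural-number index registers, real registers and a real memory.
  Memory cells are addressed only through index registers. The only real constants in
  programs are integers.\<close>

record state =
  idx :: "nat \<Rightarrow> nat"
  reg :: "nat \<Rightarrow> real"
  mem :: "nat \<Rightarrow> real"

text \<open>\<open>Reg r\<close> is a real register; \<open>Mem j\<close> is the memory cell whose address is the
  content of index register \<open>j\<close>.\<close>

datatype loc = Reg nat | Mem nat

fun load :: "state \<Rightarrow> loc \<Rightarrow> real" where
  "load s (Reg r) = reg s r"
| "load s (Mem j) = mem s (idx s j)"

fun store :: "loc \<Rightarrow> real \<Rightarrow> state \<Rightarrow> state" where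
  "store (Reg r) v s = s\<lparr>reg := (reg s)(r := v)\<rparr>"
| "store (Mem j) v s = s\<lparr>mem := (mem s)(idx s j := v)\<rparr>"

definition store_idx :: "nat \<Rightarrow> nat \<Rightarrow> state \<Rightarrow> state" where
  "store_idx j v s = s\<lparr>idx := (idx s)(j := v)\<rparr>"

datatype arith_op = Plus | Minus | Times | Divide

fun arith :: "arith_op \<Rightarrow> real \<Rightarrow> real \<Rightarrow> real" where
  "arith Plus a b = a + b"
| "arith Minus a b = a - b"
| "arith Times a b = a * b"
| "arith Divide a b = a / b"

datatype test = RealLess loc loc | IndexLess nat nat

fun holds :: "test \<Rightarrow> state \<Rightarrow> bool" where
  "holds (RealLess a b) s \<longleftrightarrow> load s a < load s b"
| "holds (IndexLess i j) s \<longleftrightarrow> idx s i < idx s j"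

datatype cmd =
    Skip
  | Const loc int
  | Copy loc loc
  | Arith arith_op loc loc loc
  | IndexZero nat
  | IndexCopy nat nat
  | IndexSuc nat
  | IndexPred nat
  | Seq cmd cmd
  | If test cmd cmd
  | While test cmd

text \<open>\<open>exec c s t s'\<close>: started in \<open>s\<close>, the program \<open>c\<close> halts in \<open>s'\<close> after \<open>t\<close> operations.
  Not only real arithmetic and real comparisons are counted: assignments and all
  operations on index registers cost 1 as well, so \<open>t\<close> bounds the number of real operations.
  Division by zero is not defined: a program that attempts it gets stuck and never halts.\<close>

inductive exec :: "cmd \<Rightarrow> state \<Rightarrow> nat \<Rightarrow> state \<Rightarrow> bool" where
  Skip: "exec Skip s 0 s"
| Const: "exec (Const a m) s 1 (store a (of_int m) s)"
| Copy: "exec (Copy a b) s 1 (store a (load s b) s)"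
| Arith: "(f = Divide \<Longrightarrow> load s c \<noteq> 0) \<Longrightarrow>
    exec (Arith f a b c) s 1 (store a (arith f (load s b) (load s c)) s)"
| IndexZero: "exec (IndexZero j) s 1 (store_idx j 0 s)"
| IndexCopy: "exec (IndexCopy j i) s 1 (store_idx j (idx s i) s)"
| IndexSuc: "exec (IndexSuc j) s 1 (store_idx j (idx s j + 1) s)"
| IndexPred: "exec (IndexPred j) s 1 (store_idx j (idx s j - 1) s)"
| Seq: "exec c s t s' \<Longrightarrow> exec d s' u s'' \<Longrightarrow> exec (Seq c d) s (t + u) s''"
| IfTrue: "holds b s \<Longrightarrow> exec c s t s' \<Longrightarrow> exec (If b c d) s (1 + t) s'"
| IfFalse: "\<not> holds b s \<Longrightarrow> exec d s t s' \<Longrightarrow> exec (If b c d) s (1 + t) s'"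
| WhileFalse: "\<not> holds b s \<Longrightarrow> exec (While b c) s 1 s"
| WhileTrue: "holds b s \<Longrightarrow> exec c s t s' \<Longrightarrow> exec (While b c) s' u s'' \<Longrightarrow>
    exec (While b c) s (1 + t + u) s''"

lemma exec_deterministic:
  "exec c s t s' \<Longrightarrow> exec c s u s'' \<Longrightarrow> u = t \<and> s'' = s'"
proof (induction arbitrary: u s'' rule: exec.induct)
  case (Seq c s t s' d v s1)
  from Seq.prems show ?case by cases (use Seq.IH in blast)
next
  case (IfTrue b s c t s' d)
  from IfTrue.prems show ?case by cases (use IfTrue in blast)+
next
  case (IfFalse b s d t s' c)
  from IfFalse.prems show ?case by cases (use IfFalse in blast)+
next
  case (WhileFalse b s c)
  from WhileFalse.prems show ?case by cases (use WhileFalse in blast)+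
next
  case (WhileTrue b s c t s' v s1)
  from WhileTrue.prems show ?case by cases (use WhileTrue in blast)+
qed (auto elim: exec.cases)

text \<open>The input size is in index register 0 and the input values are in the memory cells
  \<open>1, \<dots>, n\<close>; everything else is zero. The result is read off real register 0.\<close>

definition initial :: "nat \<Rightarrow> (nat \<Rightarrow> real) \<Rightarrow> state" where
  "initial n x =
     \<lparr>idx = (\<lambda>_. 0)(0 := n), reg = (\<lambda>_. 0), mem = (\<lambda>i. if i \<in> {1..n} then x i else 0)\<rparr>"

definition result :: "state \<Rightarrow> real" where
  "result s = reg s 0"

end

theory Submission
  imports Defs
begin

text \<open>Let \<open>N = n + 1\<close>. If the new point \<open>z\<close> is matched with the target \<open>j / N\<close>, then the cheapest way
  to match the sorted points \<open>x\<^sub>1, \<dots>, x\<^sub>n\<close> with the remaining targets is the increasing one; let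
  \<open>A\<^sub>j\<close> be its cost. Hence \<open>E(x\<^sub>1, \<dots>, x\<^sub>n, z)\<close> is the minimum over \<open>j\<close> of \<open>A\<^sub>j + \<bar>z - j / N\<bar>\<close>, and the
  minimizers are exactly the points \<open>j / N\<close> with \<open>A\<^sub>j\<close> minimal. Since
  \<open>A\<^sub>j\<^sub>+\<^sub>1 - A\<^sub>j = \<bar>x\<^sub>j - j / N\<bar> - \<bar>x\<^sub>j - (j + 1) / N\<bar>\<close>, a single pass over the points finds the
  minimum, and comparing a minimal \<open>A\<^sub>j\<close> with its two neighbours locates \<open>j / N\<close> strictly between
  \<open>x\<^sub>j\<^sub>-\<^sub>1\<close> and \<open>x\<^sub>j\<close> when \<open>1 < j \<le> n\<close>.\<close>

section \<open>Optimality of monotone matchings\<close>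

text \<open>The exchange step of the next lemma: uncrossing two matched pairs does not raise the
  cost.\<close>

lemma abs_diff_uncross:
  fixes a a' b b' :: "'a::linordered_idom"
  assumes "a \<le> a'" and "b \<le> b'"
  shows "\<bar>a - b\<bar> + \<bar>a' - b'\<bar> \<le> \<bar>a' - b\<bar> + \<bar>a - b'\<bar>"
  using assms by (auto simp: abs_if)

text \<open>Induction on the largest index \<open>m\<close>: one uncrossing makes the permutation
  fix \<open>m\<close>, and what remains permutes the smaller set.\<close>

lemma monotone_matching_optimal:
  fixes A :: "'i::linorder set" and a b :: "'i \<Rightarrow> real"
  assumes "finite A" and "mono_on A a" and "mono_on A b" and "\<sigma> permutes A"
  shows "(\<Sum>i\<in>A. \<bar>a i - b i\<bar>) \<le> (\<Sum>i\<in>A. \<bar>a (\<sigma> i) - b i\<bar>)"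
  using assms
proof (induction A arbitrary: \<sigma> rule: finite_linorder_max_induct)
  case empty
  then show ?case by simp
next
  case (insert m A)
  define p where "p = inv \<sigma> m"
  define \<tau> where "\<tau> = \<sigma> \<circ> transpose p m"
  have \<sigma>p: "\<sigma> p = m"
    unfolding p_def using insert.prems(3) permutes_inverses(1) by metis
  have p: "p \<in> insert m A"
    unfolding p_def using insert.prems(3) permutes_in_image permutes_inv by (metis insertI1)
  have m: "m \<notin> A"
    using insert.hyps(2) by blast
  have \<tau>m: "\<tau> m = m"
    by (simp add: \<tau>_def \<sigma>p)
  have "\<tau> permutes insert m A"
    unfolding \<tau>_def using insert.prems(3) p by (intro permutes_compose permutes_swap_id) auto
  then have "\<tau> permutes A"
    using \<tau>m by (auto intro: permutes_superset)
  then have IH: "(\<Sum>i\<in>A. \<bar>a i - b i\<bar>) \<le> (\<Sum>i\<in>A. \<bar>a (\<tau> i) - b i\<bar>)"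
    using insert.prems by (intro insert.IH) (auto intro: mono_on_subset)
  have "(\<Sum>i\<in>insert m A. \<bar>a (\<tau> i) - b i\<bar>) \<le> (\<Sum>i\<in>insert m A. \<bar>a (\<sigma> i) - b i\<bar>)"
  proof (cases "p = m")
    case True
    then show ?thesis by (simp add: \<tau>_def)
  next
    case False
    then have pA: "p \<in> A"
      using p by simp
    have split: "(\<Sum>i\<in>insert m A. f i) = f m + f p + sum f (A - {p})" for f :: "'i \<Rightarrow> real"
      using insert.hyps(1) m pA by (simp add: sum.remove)
    have \<sigma>m: "\<sigma> m \<in> insert m A"
      using insert.prems(3) permutes_in_image by (metis insertI1)
    have "\<sigma> m \<le> m" "p \<le> m"
      using \<sigma>m pA insert.hyps(2) by auto
    then have le: "a (\<sigma> m) \<le> a m" "b p \<le> b m"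
      using insert.prems(1,2) \<sigma>m p by (auto intro: mono_onD)
    have "(\<Sum>i\<in>A - {p}. \<bar>a (\<tau> i) - b i\<bar>) = (\<Sum>i\<in>A - {p}. \<bar>a (\<sigma> i) - b i\<bar>)"
      using m by (intro sum.cong) (auto simp: \<tau>_def transpose_def)
    moreover have "\<tau> p = \<sigma> m"
      by (simp add: \<tau>_def)
    ultimately show ?thesis
      unfolding split using abs_diff_uncross[OF le] by (simp add: \<tau>m \<sigma>p)
  qed
  moreover have "(\<Sum>i\<in>insert m A. \<bar>a i - b i\<bar>) \<le> (\<Sum>i\<in>insert m A. \<bar>a (\<tau> i) - b i\<bar>)"
    using IH m insert.hyps(1) \<tau>m by simp
  ultimately show ?case by linarith
qed

section \<open>The minimizers of the energy\<close>

text \<open>The increasing enumeration of the target indices other than \<open>j\<close>.\<close>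

definition skip :: "nat \<Rightarrow> nat \<Rightarrow> nat" where
  "skip j i = (if i < j then i else i + 1)"

lemma bij_betw_skip:
  assumes "j \<in> {1..n + 1}"
  shows "bij_betw (skip j) {1..n} ({1..n + 1} - {j})"
  by (rule bij_betw_byWitness[where f' = "\<lambda>i. if i < j then i else i - 1"])
    (use assms in \<open>auto simp: skip_def\<close>)

lemma sum_split_skip:
  fixes g :: "nat \<Rightarrow> 'a::comm_monoid_add"
  assumes "j \<in> {1..n + 1}"
  shows "(\<Sum>i=1..n + 1. g i) = g j + (\<Sum>i=1..n. g (skip j i))"
proof -
  have "(\<Sum>i=1..n. g (skip j i)) = sum g ({1..n + 1} - {j})"
    by (rule sum.reindex_bij_betw[OF bij_betw_skip[OF assms]])
  then show ?thesis
    using sum.remove[OF _ assms, of g] by simp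
qed

text \<open>This is \<open>A\<^sub>j\<close>; the target \<open>j / (n + 1)\<close> is reserved for
  the new point.\<close>

definition insertion_cost :: "nat \<Rightarrow> (nat \<Rightarrow> real) \<Rightarrow> nat \<Rightarrow> real" where
  "insertion_cost n x j = (\<Sum>i=1..n. \<bar>x i - real (skip j i) / real (n + 1)\<bar>)"

text \<open>Moving the gap from \<open>j\<close> to \<open>j + 1\<close> changes a single target
  index, that of \<open>x j\<close>, from \<open>j + 1\<close> to \<open>j\<close>.\<close>

lemma insertion_cost_Suc:
  assumes "j \<in> {1..n}"
  shows "insertion_cost n x (Suc j) = insertion_cost n x j
    + \<bar>x j - real j / real (n + 1)\<bar> - \<bar>x j - real (j + 1) / real (n + 1)\<bar>"
proof -
  have "(\<Sum>i\<in>{1..n} - {j}. \<bar>x i - real (skip (Suc j) i) / real (n + 1)\<bar>)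
      = (\<Sum>i\<in>{1..n} - {j}. \<bar>x i - real (skip j i) / real (n + 1)\<bar>)"
    by (intro sum.cong) (auto simp: skip_def)
  then show ?thesis
    using assms by (simp add: insertion_cost_def sum.remove[of _ j] skip_def)
qed

lemma energy_le_insertion_cost:
  assumes "j \<in> {1..n + 1}"
  shows "energy (n + 1) (x(n + 1 := z)) \<le> insertion_cost n x j + \<bar>z - real j / real (n + 1)\<bar>"
proof -
  \<comment> \<open>The cycle that gives target \<open>j\<close> the new point and every other
    target the old point that \<open>skip j\<close> sends to it.\<close>
  define \<pi> where "\<pi> i = (if i \<in> {j..n + 1} then if i = j then n + 1 else i - 1 else i)" for i
  have "\<pi> permutes {1..n + 1}"
  proof (rule bij_imp_permutes)
    show "bij_betw \<pi> {1..n + 1} {1..n + 1}"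
      by (rule bij_betw_byWitness[where f' = "\<lambda>i. if i = n + 1 then j else skip j i"])
        (use assms in \<open>auto simp: \<pi>_def skip_def\<close>)
  qed (use assms in \<open>auto simp: \<pi>_def\<close>)
  then have "energy (n + 1) (x(n + 1 := z))
      \<le> (\<Sum>i=1..n + 1. \<bar>(x(n + 1 := z)) (\<pi> i) - real i / real (n + 1)\<bar>)"
    unfolding energy_def by (intro Min_le) (auto intro: finite_permutations)
  also have "\<dots> = \<bar>z - real j / real (n + 1)\<bar> + insertion_cost n x j"
  proof -
    have "\<pi> j = n + 1" and "\<pi> (skip j i) = i" if "i \<in> {1..n}" for i
      using assms that by (auto simp: \<pi>_def skip_def)
    then show ?thesis
      unfolding sum_split_skip[OF assms] insertion_cost_def
      using assms by (intro arg_cong2[where f = "(+)"] sum.cong) (auto simp: \<pi>_def)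
  qed
  finally show ?thesis by simp
qed

text \<open>Take \<open>j\<close> to be the target of the new point in an optimal permutation;
  deleting this pair leaves a matching of the sorted points, to which
  \<open>monotone_matching_optimal\<close> applies.\<close>

lemma insertion_cost_le_energy:
  assumes "sorted_points n x"
  obtains j where "j \<in> {1..n + 1}"
    and "insertion_cost n x j + \<bar>z - real j / real (n + 1)\<bar> \<le> energy (n + 1) (x(n + 1 := z))"
proof -
  let ?y = "x(n + 1 := z)"
  let ?S = "(\<lambda>\<pi>. \<Sum>i=1..n + 1. \<bar>?y (\<pi> i) - real i / real (n + 1)\<bar>) ` {\<pi>. \<pi> permutes {1..n + 1}}"
  have "energy (n + 1) ?y \<in> ?S"
    unfolding energy_def by (intro Min_in) (auto intro: finite_permutations permutes_id)
  then obtain \<pi> where \<pi>: "\<pi> permutes {1..n + 1}"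
    and E: "energy (n + 1) ?y = (\<Sum>i=1..n + 1. \<bar>?y (\<pi> i) - real i / real (n + 1)\<bar>)"
    by blast
  define j where "j = inv \<pi> (n + 1)"
  have \<pi>j: "\<pi> j = n + 1"
    unfolding j_def using \<pi> permutes_inverses(1) by metis
  have j: "j \<in> {1..n + 1}"
    using \<pi> \<pi>j permutes_in_image[OF \<pi>, of j] by simp
  \<comment> \<open>\<open>\<pi>\<close> with that pair deleted and the targets renumbered; the
    identity outside \<open>{1..n}\<close> is what \<open>permutes\<close> demands.\<close>
  define \<sigma> where "\<sigma> i = (if i \<in> {1..n} then \<pi> (skip j i) else i)" for i
  have "bij_betw \<pi> ({1..n + 1} - {j}) ({1..n + 1} - {n + 1})"
    using permutes_imp_bij[OF \<pi>] j \<pi>j by (intro bij_betw_DiffI) (auto simp: bij_betw_def)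
  moreover have "{1..n + 1} - {n + 1} = {1..n}"
    by auto
  ultimately have "bij_betw (\<pi> \<circ> skip j) {1..n} {1..n}"
    using bij_betw_trans[OF bij_betw_skip[OF j]] by simp
  then have bij: "bij_betw \<sigma> {1..n} {1..n}"
    by (rule iffD1[OF bij_betw_cong, rotated]) (simp add: \<sigma>_def)
  then have \<sigma>: "\<sigma> permutes {1..n}"
    by (rule bij_imp_permutes) (auto simp: \<sigma>_def)
  have "insertion_cost n x j \<le> (\<Sum>i=1..n. \<bar>x (\<sigma> i) - real (skip j i) / real (n + 1)\<bar>)"
    unfolding insertion_cost_def
  proof (rule monotone_matching_optimal)
    show "mono_on {1..n} (\<lambda>i. real (skip j i) / real (n + 1))"
      by (intro mono_onI divide_right_mono) (auto simp: skip_def)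
  qed (use assms \<sigma> in \<open>auto simp: sorted_points_def\<close>)
  also have "\<dots> = (\<Sum>i=1..n. \<bar>?y (\<pi> (skip j i)) - real (skip j i) / real (n + 1)\<bar>)"
  proof (rule sum.cong)
    fix i assume i: "i \<in> {1..n}"
    then have "\<sigma> i \<in> {1..n}"
      using bij by (auto simp: bij_betw_def)
    \<comment> \<open>Since \<open>\<sigma> i \<le> n\<close>, the updated value at
      \<open>n + 1\<close> is not read.\<close>
    then show "\<bar>x (\<sigma> i) - real (skip j i) / real (n + 1)\<bar>
        = \<bar>?y (\<pi> (skip j i)) - real (skip j i) / real (n + 1)\<bar>"
      using i by (auto simp: \<sigma>_def)
  qed simp
  finally have "insertion_cost n x j + \<bar>z - real j / real (n + 1)\<bar> \<le> energy (n + 1) ?y"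
    unfolding E sum_split_skip[OF j] using \<pi>j by simp
  with j show ?thesis
    by (rule that)
qed

lemma minimizer_iff:
  assumes "sorted_points n x"
  shows "minimizer n x z \<longleftrightarrow> (\<exists>j\<in>{1..n + 1}. z = real j / real (n + 1)
    \<and> (\<forall>i\<in>{1..n + 1}. insertion_cost n x j \<le> insertion_cost n x i))"
proof
  assume z: "minimizer n x z"
  obtain j where j: "j \<in> {1..n + 1}"
    and le: "insertion_cost n x j + \<bar>z - real j / real (n + 1)\<bar> \<le> energy (n + 1) (x(n + 1 := z))"
    using insertion_cost_le_energy[OF assms] by blast
  \<comment> \<open>Compare with the competitor \<open>i / (n + 1)\<close>, whose distance to target
    \<open>i\<close> is 0.\<close>
  have min: "energy (n + 1) (x(n + 1 := z)) \<le> insertion_cost n x i" if i: "i \<in> {1..n + 1}" for i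
  proof -
    have "0 \<le> real i / real (n + 1)" "real i / real (n + 1) \<le> 1"
      using i by auto
    then have "energy (n + 1) (x(n + 1 := z)) \<le> energy (n + 1) (x(n + 1 := real i / real (n + 1)))"
      using z unfolding minimizer_def is_arg_min_linorder by blast
    also have "\<dots> \<le> insertion_cost n x i"
      using energy_le_insertion_cost[OF i, of x "real i / real (n + 1)"] by simp
    finally show ?thesis .
  qed
  \<comment> \<open>The case \<open>i = j\<close> of \<open>min\<close> forces the distance term in
    \<open>le\<close> to vanish.\<close>
  have "z = real j / real (n + 1)"
    using le min[OF j] by simp
  moreover have "insertion_cost n x j \<le> insertion_cost n x i" if "i \<in> {1..n + 1}" for i
    using le min[OF that] by simp
  ultimately show "\<exists>j\<in>{1..n + 1}. z = real j / real (n + 1)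
      \<and> (\<forall>i\<in>{1..n + 1}. insertion_cost n x j \<le> insertion_cost n x i)"
    using j by blast
next
  assume "\<exists>j\<in>{1..n + 1}. z = real j / real (n + 1)
    \<and> (\<forall>i\<in>{1..n + 1}. insertion_cost n x j \<le> insertion_cost n x i)"
  then obtain j where j: "j \<in> {1..n + 1}" and z: "z = real j / real (n + 1)"
    and min: "\<forall>i\<in>{1..n + 1}. insertion_cost n x j \<le> insertion_cost n x i"
    by blast
  have "energy (n + 1) (x(n + 1 := z)) \<le> energy (n + 1) (x(n + 1 := y))" for y
  proof -
    obtain i where i: "i \<in> {1..n + 1}"
      and le: "insertion_cost n x i + \<bar>y - real i / real (n + 1)\<bar> \<le> energy (n + 1) (x(n + 1 := y))"
      using insertion_cost_le_energy[OF assms] by blast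
    have "energy (n + 1) (x(n + 1 := z)) \<le> insertion_cost n x j"
      using energy_le_insertion_cost[OF j, of x z] z by simp
    also have "\<dots> \<le> insertion_cost n x i"
      using min i by blast
    finally show ?thesis
      using le by linarith
  qed
  then show "minimizer n x z"
    using j z unfolding minimizer_def is_arg_min_linorder by auto
qed

text \<open>Minimality against the two neighbours puts \<open>x k\<close> at or below the midpoint
  of targets \<open>k\<close> and \<open>k + 1\<close>, and \<open>x (k + 1)\<close> at or above
  that of \<open>k + 1\<close> and \<open>k + 2\<close>.\<close>

lemma minimizer_between:
  assumes "sorted_points n x" and "minimizer n x z" and "1 \<le> k" and "k + 1 \<le> n"
    and "z = (real k + 1) / (real n + 1)"
  shows "x k < z" and "z < x (k + 1)"
proof -
  obtain j where j: "z = real j / real (n + 1)"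
    and min: "\<forall>i\<in>{1..n + 1}. insertion_cost n x j \<le> insertion_cost n x i"
    using assms(1,2) minimizer_iff by blast
  have j_eq: "j = k + 1"
    using j assms(5) by (simp add: field_simps flip: of_nat_Suc)
  \<comment> \<open>The bounds on \<open>k\<close> keep both neighbours \<open>k\<close> and
    \<open>k + 2\<close> inside \<open>{1..n + 1}\<close>.\<close>
  have "insertion_cost n x (Suc k) \<le> insertion_cost n x k"
    "insertion_cost n x (Suc k) \<le> insertion_cost n x (Suc (Suc k))"
    using min assms(3,4) j_eq by auto
  then have le: "\<bar>x k - real k / real (n + 1)\<bar> \<le> \<bar>x k - real (k + 1) / real (n + 1)\<bar>"
    "\<bar>x (k + 1) - real (k + 2) / real (n + 1)\<bar> \<le> \<bar>x (k + 1) - real (k + 1) / real (n + 1)\<bar>"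
    using assms(3,4) by (simp_all add: insertion_cost_Suc)
  have "real k / real (n + 1) < real (k + 1) / real (n + 1)"
    "real (k + 1) / real (n + 1) < real (k + 2) / real (n + 1)"
    by (simp_all add: divide_strict_right_mono)
  moreover have "z = real (k + 1) / real (n + 1)"
    using j j_eq by simp
  ultimately show "x k < z" "z < x (k + 1)"
    using le by linarith+
qed

section \<open>A linear-time program\<close>

text \<open>Asserts termination; as \<open>exec\<close> is deterministic, it behaves like a weakest
  precondition with cost.\<close>

definition runs :: "cmd \<Rightarrow> state \<Rightarrow> (nat \<Rightarrow> state \<Rightarrow> bool) \<Rightarrow> bool" where
  "runs c s Q \<longleftrightarrow> (\<exists>t s'. exec c s t s' \<and> Q t s')"

lemma runs_mono: "runs c s P \<Longrightarrow> (\<And>t s'. P t s' \<Longrightarrow> Q t s') \<Longrightarrow> runs c s Q"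
  unfolding runs_def by blast

inductive_cases exec_elims:
  "exec Skip s t s'"
  "exec (Const a m) s t s'"
  "exec (Copy a b) s t s'"
  "exec (Arith f a b d) s t s'"
  "exec (IndexZero j) s t s'"
  "exec (IndexSuc j) s t s'"
  "exec (Seq c c') s t s'"
  "exec (If p c c') s t s'"

text \<open>Lets the simplifier run straight-line code symbolically and add up its cost.\<close>

lemma runs_simps [simp]:
  "runs Skip s Q \<longleftrightarrow> Q 0 s"
  "runs (Const a m) s Q \<longleftrightarrow> Q 1 (store a (of_int m) s)"
  "runs (Copy a b) s Q \<longleftrightarrow> Q 1 (store a (load s b) s)"
  "runs (Arith f a b d) s Q \<longleftrightarrow>
    (f = Divide \<longrightarrow> load s d \<noteq> 0) \<and> Q 1 (store a (arith f (load s b) (load s d)) s)"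
  "runs (IndexZero j) s Q \<longleftrightarrow> Q 1 (store_idx j 0 s)"
  "runs (IndexSuc j) s Q \<longleftrightarrow> Q 1 (store_idx j (idx s j + 1) s)"
  "runs (Seq c c') s Q \<longleftrightarrow> runs c s (\<lambda>t s'. runs c' s' (\<lambda>u. Q (t + u)))"
  "runs (If p c c') s Q \<longleftrightarrow>
    (if holds p s then runs c s (\<lambda>t. Q (1 + t)) else runs c' s (\<lambda>t. Q (1 + t)))"
  unfolding runs_def
  by (auto elim!: exec_elims simp del: One_nat_def intro: exec.intros
    | force elim: exec_elims intro: exec.intros)+

text \<open>For loops with exactly \<open>n\<close> rounds, which the first argument of
  \<open>I\<close> counts. Each round costs at most \<open>K\<close> plus one test, and the failing
  test adds 1.\<close>

lemma runs_While:
  assumes "I 0 s"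
    and "\<And>i s. i < n \<Longrightarrow> I i s \<Longrightarrow> holds b s \<and> runs c s (\<lambda>t s'. t \<le> K \<and> I (Suc i) s')"
    and "\<And>s. I n s \<Longrightarrow> \<not> holds b s"
  shows "runs (While b c) s (\<lambda>t s'. t \<le> (K + 1) * n + 1 \<and> I n s')"
proof -
  have "runs (While b c) s (\<lambda>t s'. t \<le> (K + 1) * (n - i) + 1 \<and> I n s')" if "i \<le> n" "I i s" for i s
    using that
  proof (induction "n - i" arbitrary: i s)
    case 0
    then show ?case
      using assms(3) unfolding runs_def by (auto intro!: exI WhileFalse)
  next
    case (Suc m)
    then have b: "holds b s" and "runs c s (\<lambda>t s'. t \<le> K \<and> I (Suc i) s')"
      using assms(2)[of i s] by auto
    then obtain t s' where c: "exec c s t s'" "t \<le> K" "I (Suc i) s'"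
      unfolding runs_def by blast
    then obtain u s'' where w: "exec (While b c) s' u s''" "u \<le> (K + 1) * (n - Suc i) + 1" "I n s''"
      using Suc.hyps(1)[of "Suc i" s'] Suc.hyps(2) Suc.prems unfolding runs_def by fastforce
    have "n - i = Suc (n - Suc i)"
      using Suc.hyps(2) by simp
    then have "1 + t + u \<le> (K + 1) * (n - i) + 1"
      using c(2) w(2) by simp
    then show ?case
      using WhileTrue[OF b c(1) w(1)] w(3) unfolding runs_def by blast
  qed
  from this[of 0 s] show ?thesis
    using assms(1) by simp
qed

text \<open>Throughout, real register 7 holds 0. The void copy gives both branches the same cost.\<close>

definition Abs :: "nat \<Rightarrow> cmd" where
  "Abs r = If (RealLess (Reg r) (Reg 7)) (Arith Minus (Reg r) (Reg 7) (Reg r)) (Copy (Reg r) (Reg r))"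

lemma runs_Abs [simp]:
  "reg s 7 = 0 \<Longrightarrow> runs (Abs r) s Q \<longleftrightarrow> Q 2 (store (Reg r) \<bar>reg s r\<bar> s)"
  by (simp add: Abs_def abs_if numeral_2_eq_2)

text \<open>No instruction turns an index into a real, so \<open>n + 1\<close> is built in register
  3 by repeated addition of 1.\<close>

definition count_points :: cmd where
  "count_points =
    Seq (Const (Reg 5) 1) (Seq (Const (Reg 3) 1)
      (While (IndexLess 1 0) (Seq (Arith Plus (Reg 3) (Reg 3) (Reg 5)) (IndexSuc 1))))"

lemma runs_count_points:
  "runs count_points (initial n x) (\<lambda>t s. t \<le> 3 * n + 3 \<and> idx s 0 = n \<and> reg s 1 = 0 \<and> reg s 2 = 0
    \<and> reg s 3 = real (n + 1) \<and> reg s 5 = 1 \<and> reg s 7 = 0 \<and> (\<forall>i\<in>{1..n}. mem s i = x i))"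
proof -
  define I :: "nat \<Rightarrow> state \<Rightarrow> bool" where "I i s \<longleftrightarrow> idx s 0 = n \<and> idx s 1 = i \<and> reg s 1 = 0 \<and> reg s 2 = 0
    \<and> reg s 3 = real (i + 1) \<and> reg s 5 = 1 \<and> reg s 7 = 0 \<and> (\<forall>i\<in>{1..n}. mem s i = x i)" for i s
  let ?b = "IndexLess 1 0" and ?c = "Seq (Arith Plus (Reg 3) (Reg 3) (Reg 5)) (IndexSuc 1)"
  let ?s = "store (Reg 3) 1 (store (Reg 5) 1 (initial n x))"
  have "I 0 ?s"
    by (simp add: I_def initial_def)
  \<comment> \<open>Two operations and a test per round; with the last test and the two constants
    this is \<open>3 * n + 3\<close>.\<close>
  then have "runs (While ?b ?c) ?s (\<lambda>t s'. t \<le> (2 + 1) * n + 1 \<and> I n s')"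
    by (rule runs_While) (auto simp: I_def store_idx_def)
  then show ?thesis
    by (auto simp: count_points_def I_def elim!: runs_mono)
qed

text \<open>Real registers: 0 best candidate \<open>j / N\<close>, 1 current \<open>A\<^sub>j - A\<^sub>1\<close>, 2 its smallest value so far,
  3 current target \<open>j / N\<close>, 4 step \<open>1 / N\<close>.\<close>

definition scan_step :: cmd where
  "scan_step =
    Seq (IndexSuc 1)
    (Seq (Arith Minus (Reg 5) (Mem 1) (Reg 3))
    (Seq (Abs 5)
    (Seq (Arith Plus (Reg 1) (Reg 1) (Reg 5))
    (Seq (Arith Plus (Reg 3) (Reg 3) (Reg 4))
    (Seq (Arith Minus (Reg 5) (Mem 1) (Reg 3))
    (Seq (Abs 5)
    (Seq (Arith Minus (Reg 1) (Reg 1) (Reg 5))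
      (If (RealLess (Reg 1) (Reg 2)) (Seq (Copy (Reg 2) (Reg 1)) (Copy (Reg 0) (Reg 3))) Skip))))))))"

text \<open>After \<open>i\<close> points, the targets \<open>1..i + 1\<close> have been compared.
  Costs are kept relative to \<open>A\<^sub>1\<close>: this preserves their order and lets the
  registers start at 0.\<close>

definition scan_inv :: "nat \<Rightarrow> (nat \<Rightarrow> real) \<Rightarrow> nat \<Rightarrow> state \<Rightarrow> bool" where
  "scan_inv n x i s \<longleftrightarrow> idx s 0 = n \<and> idx s 1 = i
    \<and> reg s 1 = insertion_cost n x (i + 1) - insertion_cost n x 1
    \<and> reg s 3 = real (i + 1) / real (n + 1) \<and> reg s 4 = 1 / real (n + 1) \<and> reg s 7 = 0
    \<and> (\<forall>i\<in>{1..n}. mem s i = x i)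
    \<and> (\<exists>j\<in>{1..i + 1}. reg s 0 = real j / real (n + 1)
        \<and> reg s 2 = insertion_cost n x j - insertion_cost n x 1
        \<and> (\<forall>k\<in>{1..i + 1}. insertion_cost n x j \<le> insertion_cost n x k))"

text \<open>The cost 13 is 10 up to the final test, each \<open>Abs\<close> counting 2, plus at most
  3 for the test and its two copies.\<close>

lemma runs_scan_step:
  assumes "i < n" and inv: "scan_inv n x i s"
  shows "runs scan_step s (\<lambda>t s'. t \<le> 13 \<and> scan_inv n x (Suc i) s')"
proof -
  let ?A = "insertion_cost n x"
  obtain j where j: "j \<in> {1..i + 1}" "reg s 0 = real j / real (n + 1)"
      "reg s 2 = ?A j - ?A 1" "\<forall>k\<in>{1..i + 1}. ?A j \<le> ?A k"
    using inv unfolding scan_inv_def by blast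
  have step: "?A (Suc (Suc i)) = ?A (Suc i) + \<bar>x (Suc i) - real (Suc i) / real (n + 1)\<bar>
      - \<bar>x (Suc i) - real (Suc (Suc i)) / real (n + 1)\<bar>"
    using insertion_cost_Suc[of "Suc i" n x] assms(1) by simp
  have target: "real (Suc i) / real (n + 1) + 1 / real (n + 1) = real (Suc (Suc i)) / real (n + 1)"
    by (simp add: add_divide_distrib)
  have s: "idx s 0 = n" "idx s 1 = i" "reg s 1 = ?A (Suc i) - ?A 1"
      "reg s 3 = real (Suc i) / real (n + 1)" "reg s 4 = 1 / real (n + 1)" "reg s 7 = 0"
      "\<forall>i\<in>{1..n}. mem s i = x i" "mem s (Suc i) = x (Suc i)"
    using inv assms(1) by (auto simp: scan_inv_def)
  have Icc: "{1..Suc i + 1} = insert (Suc (Suc i)) {1..i + 1}"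
    by auto
  show ?thesis
  \<comment> \<open>The cases follow the strict test of the machine, so a tie keeps the earlier
    candidate.\<close>
  proof (cases "?A (Suc (Suc i)) < ?A j")
    case True
    then have "\<forall>k\<in>{1..Suc i + 1}. ?A (Suc (Suc i)) \<le> ?A k"
      using j(4) unfolding Icc by (auto intro: order.strict_implies_order order.strict_trans2)
    then show ?thesis
      using s j(3) step target True
      by (simp add: scan_step_def store_idx_def scan_inv_def bexI[of _ "Suc (Suc i)"])
  next
    case False
    then have "\<forall>k\<in>{1..Suc i + 1}. ?A j \<le> ?A k"
      using j(4) unfolding Icc by auto
    then show ?thesis
      using s j(1-3) step target False
      by (simp add: scan_step_def store_idx_def scan_inv_def bexI[of _ j])
  qed
qed

definition find_minimizer :: cmd where
  "find_minimizer =
    Seq count_points (Seq (Arith Divide (Reg 4) (Reg 5) (Reg 3)) (Seq (Copy (Reg 3) (Reg 4))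
      (Seq (Copy (Reg 0) (Reg 4)) (Seq (IndexZero 1) (While (IndexLess 1 0) scan_step)))))"

text \<open>The cost is \<open>3 * n + 3\<close> for counting, 4 for the instructions in between and
  \<open>14 * n + 1\<close> for the scan.\<close>

lemma runs_find_minimizer:
  assumes "sorted_points n x"
  shows "runs find_minimizer (initial n x) (\<lambda>t s. t \<le> 17 * n + 8 \<and> minimizer n x (result s))"
proof -
  have scan: "runs (While (IndexLess 1 0) scan_step) s
      (\<lambda>t s'. t \<le> 14 * n + 1 \<and> minimizer n x (result s'))" if "scan_inv n x 0 s" for s
  proof -
    have "runs (While (IndexLess 1 0) scan_step) s (\<lambda>t s'. t \<le> (13 + 1) * n + 1 \<and> scan_inv n x n s')"
    proof (rule runs_While[where I = "scan_inv n x", OF that])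
      show "holds (IndexLess 1 0) s \<and> runs scan_step s (\<lambda>t s'. t \<le> 13 \<and> scan_inv n x (Suc i) s')"
        if "i < n" "scan_inv n x i s" for i s
        using runs_scan_step[OF that] that by (simp add: scan_inv_def[of n x i])
    qed (simp add: scan_inv_def)
    \<comment> \<open>At \<open>i = n\<close> all \<open>n + 1\<close> targets have been
      compared.\<close>
    then show ?thesis
      by (rule runs_mono) (auto simp: minimizer_iff[OF assms] scan_inv_def result_def)
  qed
  show ?thesis
    unfolding find_minimizer_def runs_simps(7)
  proof (rule runs_mono[OF runs_count_points], goal_cases)
    case (1 t s)
    \<comment> \<open>Both cost registers are still 0, which is right for the lone candidate
      \<open>j = 1\<close>.\<close>
    let ?s = "store_idx 1 0 (s\<lparr>reg := (reg s)(4 := 1 / real (n + 1), 3 := 1 / real (n + 1),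
      0 := 1 / real (n + 1))\<rparr>)"
    have "scan_inv n x 0 ?s"
      using 1 by (simp add: scan_inv_def store_idx_def)
    from scan[OF this] show ?case
      using 1 by (auto elim!: runs_mono)
  qed
qed

theorem theorem1:
  "(\<exists>(c :: cmd) (C :: nat). \<forall>n\<ge>1. \<forall>x :: nat \<Rightarrow> real. sorted_points n x \<longrightarrow>
      (\<exists>t s. exec c (initial n x) t s \<and> t \<le> C * n \<and> minimizer n x (result s)))
   \<and> (\<forall>(n :: nat) (x :: nat \<Rightarrow> real) (z :: real).
      n \<ge> 1 \<longrightarrow> sorted_points n x \<longrightarrow> minimizer n x z \<longrightarrow>
        (\<exists>k :: int. 1 \<le> k \<and> k \<le> int n + 1 \<and> z = of_int k / (real n + 1))
        \<and> (\<forall>k :: nat. 1 \<le> k \<longrightarrow> k + 1 \<le> n \<longrightarrow> z = (real k + 1) / (real n + 1) \<longrightarrow>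
             x k < (real k + 1) / (real n + 1) \<and> (real k + 1) / (real n + 1) < x (k + 1)))"
proof (rule conjI)
  \<comment> \<open>The constant is 25 = 17 + 8, as \<open>8 \<le> 8 * n\<close>.\<close>
  have "\<exists>t s. exec find_minimizer (initial n x) t s \<and> t \<le> 25 * n \<and> minimizer n x (result s)"
    if "1 \<le> n" and "sorted_points n x" for n x
  proof -
    have "runs find_minimizer (initial n x) (\<lambda>t s. t \<le> 25 * n \<and> minimizer n x (result s))"
      using runs_find_minimizer[OF that(2)] by (rule runs_mono) (use that(1) in auto)
    then show ?thesis
      unfolding runs_def .
  qed
  then show "\<exists>(c :: cmd) (C :: nat). \<forall>n\<ge>1. \<forall>x :: nat \<Rightarrow> real. sorted_points n x \<longrightarrow>
      (\<exists>t s. exec c (initial n x) t s \<and> t \<le> C * n \<and> minimizer n x (result s))"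
    by blast
next
  have "\<exists>k :: int. 1 \<le> k \<and> k \<le> int n + 1 \<and> z = of_int k / (real n + 1)"
    if sorted: "sorted_points n x" and min: "minimizer n x z" for n x z
  proof -
    obtain j where "j \<in> {1..n + 1}" "z = real j / real (n + 1)"
      using minimizer_iff[OF sorted] min by blast
    then show ?thesis
      by (intro exI[of _ "int j"]) (auto simp: add.commute)
  qed
  then show "\<forall>(n :: nat) (x :: nat \<Rightarrow> real) (z :: real).
      n \<ge> 1 \<longrightarrow> sorted_points n x \<longrightarrow> minimizer n x z \<longrightarrow>
        (\<exists>k :: int. 1 \<le> k \<and> k \<le> int n + 1 \<and> z = of_int k / (real n + 1))
        \<and> (\<forall>k :: nat. 1 \<le> k \<longrightarrow> k + 1 \<le> n \<longrightarrow> z = (real k + 1) / (real n + 1) \<longrightarrow>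
             x k < (real k + 1) / (real n + 1) \<and> (real k + 1) / (real n + 1) < x (k + 1))"
    using minimizer_between by blast
qed

end
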